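(* For every integer $n\ge 4$, there exist susceptance values $b_{km}$ on the edges of the complete graph $K_n$ for which the lossless, zero-injection power flow equations of $K_n$ have infinitely many real solutions $(x_1,\dots,x_{n-1},y_1,\dots,y_{n-1})\in\mathbb{R}^{2(n-1)}$.
   Context: A power network on $n$ nodes is a connected undirected graph $G=(V,E)$ with $V=\{v_0,\dots,v_{n-1}\}$. Each edge $v_kv_m\in E$ carries a nonzero real susceptance $b_{km}=b_{mk}$, and $b_{km}=0$ if $v_k$ and $v_m$ are not adjacent. The (lossless, zero-injection, unit-voltage) power flow equations of $G$ with these susceptances are the $2(n-1)$ polynomial equations, for $k=1,\dots,n-1$, $$x_k^2+y_k^2=1,\qquad \sum_{m=0}^{n-1} b_{km}(x_ky_m-x_my_k)=0,$$ in the variables $x_1,\dots,x_{n-1},y_1,\dots,y_{n-1}$, where $x_0=1$ and $y_0=0$ are fixed (the slack node). $K_n$ is the complete graph on $v_0,\dots,v_{n-1}$. *)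

theory Defs
  imports Complex_Main "HOL-Library.FuncSet"
begin

text \<open>
  Node \<open>v\<^sub>k\<close> is the natural number \<open>k\<close>, and an undirected edge is a two-element set of nodes.
\<close>

definition complete_edges :: "nat \<Rightarrow> nat set set" where
  "complete_edges n = {{k, m} |k m. k < n \<and> m < n \<and> k \<noteq> m}"

definition connected_graph :: "nat \<Rightarrow> nat set set \<Rightarrow> bool" where
  "connected_graph n E \<longleftrightarrow> (\<forall>k<n. \<forall>m<n. (k, m) \<in> {(i, j). {i, j} \<in> E}\<^sup>*)"

text \<open>
  The last conjunct includes \<open>b k k = 0\<close>, as a singleton is never an edge.
  Values of \<open>b\<close> at indices \<open>\<ge> n\<close> are unconstrained and never used.
\<close>

definition power_network :: "nat \<Rightarrow> nat set set \<Rightarrow> (nat \<Rightarrow> nat \<Rightarrow> real) \<Rightarrow> bool" where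
  "power_network n E b \<longleftrightarrow>
     0 < n \<and> E \<subseteq> complete_edges n \<and> connected_graph n E \<and>
     (\<forall>k<n. \<forall>m<n. b k m = b m k \<and> (b k m \<noteq> 0 \<longleftrightarrow> {k, m} \<in> E))"

text \<open>
  The unknowns are \<open>x k\<close>, \<open>y k\<close> for \<open>1 \<le> k < n\<close>; the slack values at node 0 are substituted by
  the function updates.
\<close>

definition power_flow_equations ::
  "nat \<Rightarrow> (nat \<Rightarrow> nat \<Rightarrow> real) \<Rightarrow> (nat \<Rightarrow> real) \<Rightarrow> (nat \<Rightarrow> real) \<Rightarrow> bool" where
  "power_flow_equations n b x y \<longleftrightarrow>
     (\<forall>k\<in>{1..<n}.
        (x k)\<^sup>2 + (y k)\<^sup>2 = 1 \<and>
        (\<Sum>m<n. b k m * (x k * (y(0 := 0)) m - (x(0 := 1)) m * y k)) = 0)"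

text \<open>
  A point of \<open>2(n - 1)\<close>-dimensional real space is a pair of functions extensional on
  \<open>{1..<n}\<close>, so that distinct solutions differ in some actual coordinate.
\<close>

definition power_flow_solutions ::
  "nat \<Rightarrow> (nat \<Rightarrow> nat \<Rightarrow> real) \<Rightarrow> ((nat \<Rightarrow> real) \<times> (nat \<Rightarrow> real)) set" where
  "power_flow_solutions n b =
     {(x, y) \<in> ({1..<n} \<rightarrow>\<^sub>E UNIV) \<times> ({1..<n} \<rightarrow>\<^sub>E UNIV). power_flow_equations n b x y}"

end

theory Submission
  imports Defs
begin

text \<open>
  Take susceptances in product form, \<open>b k m = c k * c m\<close>. Reading \<open>(x k, y k)\<close> as a plane
  vector, the balance equation at node \<open>k\<close> says that this vector is parallel to the weighted sum
  \<open>\<Sum>m. c m * (x m, y m)\<close>, whence every configuration of unit vectors whose weighted sum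
  is zero solves all the equations at once (\<open>power_flow_equations_if_balanced\<close>). So it suffices to
  choose nonzero weights for which such configurations form a continuum with the slack vector held
  at \<open>(1, 0)\<close>. Give nodes 1 and 2 opposite vectors \<open>u\<close> and \<open>-u\<close> and put all the
  remaining \<open>n - 3\<close> nodes at \<open>(-1, 0)\<close>. With unit weights on all of these, the slack node must
  have weight \<open>n - 3\<close>, which is nonzero exactly because \<open>n \<ge> 4\<close>; the direction of \<open>u\<close>
  stays free.
\<close>

definition product_susceptance :: "(nat \<Rightarrow> real) \<Rightarrow> nat \<Rightarrow> nat \<Rightarrow> real" where
  "product_susceptance c k m = (if k = m then 0 else c k * c m)"

lemma power_network_product_susceptance:
  assumes "0 < n" and "\<And>k. k < n \<Longrightarrow> c k \<noteq> 0"
  shows "power_network n (complete_edges n) (product_susceptance c)"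
proof -
  have edge_iff: "{k, m} \<in> complete_edges n \<longleftrightarrow> k \<noteq> m" if "k < n" "m < n" for k m
    using that by (auto simp: complete_edges_def doubleton_eq_iff)
  have "connected_graph n (complete_edges n)"
    unfolding connected_graph_def
  proof (intro allI impI)
    fix k m assume "k < n" "m < n"
    then show "(k, m) \<in> {(i, j). {i, j} \<in> complete_edges n}\<^sup>*"
      by (cases "k = m") (auto simp: edge_iff intro: r_into_rtrancl)
  qed
  then show ?thesis
    using assms by (auto simp: power_network_def product_susceptance_def edge_iff)
qed

text \<open>
  The missing diagonal term of the susceptances is harmless, since a vector exerts no torque on
  itself. Each equation thus becomes \<open>c k\<close> times the cross product of \<open>(x k, y k)\<close> with the
  weighted sum, which is zero.
\<close>

lemma power_flow_equations_if_balanced: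
  assumes unit: "\<And>k. k \<in> {1..<n} \<Longrightarrow> (x k)\<^sup>2 + (y k)\<^sup>2 = 1"
    and balance_x: "(\<Sum>m<n. c m * (x(0 := 1)) m) = 0"
    and balance_y: "(\<Sum>m<n. c m * (y(0 := 0)) m) = 0"
  shows "power_flow_equations n (product_susceptance c) x y"
  unfolding power_flow_equations_def
proof (intro ballI conjI)
  fix k assume k: "k \<in> {1..<n}"
  show "(x k)\<^sup>2 + (y k)\<^sup>2 = 1" using unit[OF k] .
  have "(\<Sum>m<n. product_susceptance c k m * (x k * (y(0 := 0)) m - (x(0 := 1)) m * y k))
      = (\<Sum>m<n. c k * x k * (c m * (y(0 := 0)) m) - c k * y k * (c m * (x(0 := 1)) m))"
    using k by (intro sum.cong) (auto simp: product_susceptance_def algebra_simps)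
  also have "\<dots> = c k * x k * (\<Sum>m<n. c m * (y(0 := 0)) m)
                - c k * y k * (\<Sum>m<n. c m * (x(0 := 1)) m)"
    by (simp only: sum_subtractf sum_distrib_left)
  also have "\<dots> = 0"
    by (simp only: balance_x balance_y mult_zero_right diff_self)
  finally show "(\<Sum>m<n. product_susceptance c k m * (x k * (y(0 := 0)) m - (x(0 := 1)) m * y k)) = 0" .
qed

theorem lemma7:
  fixes n :: nat
  assumes "n \<ge> 4"
  shows "\<exists>b :: nat \<Rightarrow> nat \<Rightarrow> real.
           power_network n (complete_edges n) b \<and> infinite (power_flow_solutions n b)"
proof -
  define j where "j = n - 3"
  have n: "n = Suc (Suc (Suc j))" and "0 < j"
    using assms by (auto simp: j_def)
  define c :: "nat \<Rightarrow> real" where "c = (\<lambda>k. if k = 0 then real j else 1)"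
  define x where "x = (\<lambda>t :: real. restrict (\<lambda>k. if k = 1 then t else if k = 2 then - t else - 1) {1..<n})"
  define y where "y = (\<lambda>t :: real. restrict (\<lambda>k. if k = 1 then sqrt (1 - t\<^sup>2)
      else if k = 2 then - sqrt (1 - t\<^sup>2) else 0) {1..<n})"
  have "power_network n (complete_edges n) (product_susceptance c)"
    using \<open>0 < j\<close> by (intro power_network_product_susceptance) (auto simp: n c_def)
  moreover have "infinite (power_flow_solutions n (product_susceptance c))"
  proof -
    have "(x t, y t) \<in> power_flow_solutions n (product_susceptance c)" if t: "t \<in> {-1..1}" for t
    proof -
      have "t\<^sup>2 \<le> 1"
        using t by (simp add: abs_square_le_1 abs_le_iff)
      then have "power_flow_equations n (product_susceptance c) (x t) (y t)"
        by (intro power_flow_equations_if_balanced)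
           (auto simp: x_def y_def c_def n sum.lessThan_Suc_shift simp del: sum.lessThan_Suc)
      then show ?thesis
        by (simp add: power_flow_solutions_def x_def y_def)
    qed
    then have "(\<lambda>t. (x t, y t)) ` {-1..1} \<subseteq> power_flow_solutions n (product_susceptance c)"
      by blast
    moreover have "inj_on (\<lambda>t. (x t, y t)) {-1..1}"
    proof (rule inj_onI)
      fix s t assume "(x s, y s) = (x t, y t)"
      then have "x s 1 = x t 1" by simp
      then show "s = t" by (simp add: x_def n)
    qed
    then have "infinite ((\<lambda>t. (x t, y t)) ` {-1..1})"
      by (simp add: finite_image_iff infinite_Icc)
    ultimately show ?thesis
      using finite_subset by blast
  qed
  ultimately show ?thesis by blast
qed

end
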